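(* Let $\mathcal{M}=\mathcal{SE}_2(3)\times\mathbb{R}^9$ with elements $\xi=(\mathbf{T},\boldsymbol{b})$, $\mathbb{L}=\mathbb{R}^{18}$ with elements $u=(\boldsymbol{w},\boldsymbol{\tau})$, $\boldsymbol{w},\boldsymbol{\tau}\in\mathbb{R}^9$, and consider the biased inertial navigation system $\dot\xi=f_u(\xi)$ given by $$\dot{\mathbf{T}}=\mathbf{T}(\mathbf{W}-\mathbf{B}+\mathbf{N})+(\mathbf{G}-\mathbf{N})\mathbf{T},\qquad \dot{\boldsymbol{b}}=\boldsymbol{\tau},$$ where $\mathbf{W}=\boldsymbol{w}^{\wedge}$ and $\mathbf{B}=\boldsymbol{b}^{\wedge}$. Let $\mathbf{G_{TG}}=\mathbf{SE}_2(3)\ltimes\mathfrak{se}_2(3)$ with elements $X=(D,\delta)$, and let $$\phi(X,\xi)=\big(\mathbf{T}D,\,\mathbf{Ad}^{\vee}_{D^{-1}}(\boldsymbol{b}-\delta^{\vee})\big),\qquad \psi(X,u)=\big(\mathbf{Ad}^{\vee}_{D^{-1}}(\boldsymbol{w}-\delta^{\vee})+\Omega(D^{-1})^{\vee},\,\mathbf{Ad}^{\vee}_{D^{-1}}\boldsymbol{\tau}\big).$$ Then the system is equivariant under the actions $\phi$ and $\psi$; that is, for all $X\in\mathbf{G_{TG}}$, $u\in\mathbb{L}$ and $\xi\in\mathcal{M}$, $$f_{\psi_X(u)}(\xi)=\Phi_Xf_u(\xi).$$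
   Context: $\mathbf{SE}_2(3)$ is the matrix Lie group of $5\times5$ matrices $\begin{bmatrix}A&\boldsymbol{a}&\boldsymbol{b}\\0&1&0\\0&0&1\end{bmatrix}$ with $A\in\mathbf{SO}(3)$, $\boldsymbol{a},\boldsymbol{b}\in\mathbb{R}^3$; $\mathcal{SE}_2(3)$ is its underlying smooth manifold. Its Lie algebra $\mathfrak{se}_2(3)$ consists of the matrices $(\boldsymbol{\omega},\boldsymbol{v},\boldsymbol{p})^{\wedge}=\begin{bmatrix}\boldsymbol{\omega}^{\wedge}&\boldsymbol{v}&\boldsymbol{p}\\0&0&0\\0&0&0\end{bmatrix}$, where $\boldsymbol{\omega}^{\wedge}$ is the $3\times3$ skew-symmetric cross-product matrix; $(\cdot)^{\vee}:\mathfrak{se}_2(3)\to\mathbb{R}^9$ is the inverse of $(\cdot)^{\wedge}$. $\mathrm{Ad}_D[\eta]=D\eta D^{-1}$, and $\mathbf{Ad}^{\vee}_D\boldsymbol{u}=(\mathrm{Ad}_D[\boldsymbol{u}^{\wedge}])^{\vee}$ for $\boldsymbol{u}\in\mathbb{R}^9$. Here $\boldsymbol{w}=(\boldsymbol{\omega},\boldsymbol{a},\boldsymbol{\nu})$ collects the gyroscope, accelerometer and a virtual velocity input, and $\boldsymbol{b}=(\boldsymbol{b}_\omega,\boldsymbol{b}_a,\boldsymbol{b}_\nu)$ the corresponding biases. $\mathbf{N}\in\mathbb{R}^{5\times5}$ has a single nonzero entry, equal to $1$, in row $4$, column $5$. $\mathbf{G}\in\mathbb{R}^{5\times5}$ has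 the fixed gravity vector $\boldsymbol{g}\in\mathbb{R}^3$ in rows $1$–$3$ of column $4$ and zeros elsewhere. $\Omega(Z)=Z\mathbf{N}-\mathbf{N}Z=Z\mathbf{N}-\mathbf{N}\in\mathfrak{se}_2(3)$ for $Z\in\mathbf{SE}_2(3)$. The group product in $\mathbf{G_{TG}}$ is $XY=(D_XD_Y,\;\delta_X+\mathrm{Ad}_{D_X}[\delta_Y])$, with inverse $X^{-1}=(D^{-1},-\mathrm{Ad}_{D^{-1}}[\delta])$. The maps $\phi,\psi$ are right group actions; $\phi_X(\xi)=\phi(X,\xi)$, $\psi_X(u)=\psi(X,u)$. For a smooth vector field $f$ on $\mathcal{M}$, $\Phi_Xf:=\mathrm{d}\phi_X\circ f\circ\phi_{X^{-1}}$. *)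

theory Defs
  imports "HOL-Analysis.Analysis" "HOL-Algebra.Group"
begin

unbundle no cross3_syntax
unbundle set_product_syntax

type_synonym mat5 = "real^5^5"

text \<open>
  \<open>\<real>\<^sup>9\<close> is kept in its block form \<open>\<real>\<^sup>3 \<times> \<real>\<^sup>3 \<times> \<real>\<^sup>3\<close>, in the order (rotation, velocity, position).
  An input \<open>(w, \<tau>) \<in> \<real>\<^sup>1\<^sup>8\<close> is a pair of such blocks.
\<close>

type_synonym r9 = "(real^3) \<times> (real^3) \<times> (real^3)"
type_synonym state = "mat5 \<times> r9"
type_synonym input = "r9 \<times> r9"


section \<open>The group \<open>SE\<^sub>2(3)\<close> and its Lie algebra\<close>

text \<open>
  \<open>block5 c A a b\<close> has \<open>(A | a | b)\<close> as its first three rows, and \<open>c\<close> times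
  the \<open>2 \<times> 2\<close> identity in the lower right corner. Rows and columns are numbered 1 to 5; the
  literal \<open>5\<close> equals \<open>0\<close> in the index type.
\<close>

definition block5 :: "real \<Rightarrow> real^3^3 \<Rightarrow> real^3 \<Rightarrow> real^3 \<Rightarrow> mat5" where
  "block5 c A a b = vector
     [vector [A$1$1, A$1$2, A$1$3, a$1, b$1],
      vector [A$2$1, A$2$2, A$2$3, a$2, b$2],
      vector [A$3$1, A$3$2, A$3$3, a$3, b$3],
      vector [0,     0,     0,     c,   0],
      vector [0,     0,     0,     0,   c]]"

definition SE23 :: "mat5 set" where
  "SE23 = {block5 1 A a b | A a b. rotation_matrix A}"

definition hat :: "real^3 \<Rightarrow> real^3^3" where
  "hat \<omega> = matrix (\<lambda>x. cross3 \<omega> x)"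

definition wedge :: "r9 \<Rightarrow> mat5" where
  "wedge = (\<lambda>(\<omega>, v, p). block5 0 (hat \<omega>) v p)"

definition se23 :: "mat5 set" where
  "se23 = range wedge"

definition vee :: "mat5 \<Rightarrow> r9" where
  "vee = the_inv wedge"

definition Ad :: "mat5 \<Rightarrow> mat5 \<Rightarrow> mat5" where
  "Ad D \<eta> = D ** \<eta> ** matrix_inv D"

definition Ad_vee :: "mat5 \<Rightarrow> r9 \<Rightarrow> r9" where
  "Ad_vee D u = vee (Ad D (wedge u))"


section \<open>The tangent group\<close>

definition G_TG :: "(mat5 \<times> mat5) monoid" where
  "G_TG = \<lparr>carrier = SE23 \<times> se23,
           monoid.mult = (\<lambda>(D, \<delta>) (D', \<delta>'). (D ** D', \<delta> + Ad D \<delta>')),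
           one = (mat 1, 0)\<rparr>"


section \<open>The system and the actions\<close>

text \<open>
  \<open>\<phi>\<close> and \<open>ins_field\<close> are given by their formulas on the ambient space; only their values on
  \<open>\<M>\<close> matter.
\<close>

definition N5 :: mat5 where
  "N5 = (\<chi> i j. if i = 4 \<and> j = 5 then 1 else 0)"

definition G5 :: "real^3 \<Rightarrow> mat5" where
  "G5 g = block5 0 0 g 0"

definition \<Omega> :: "mat5 \<Rightarrow> mat5" where
  "\<Omega> Z = Z ** N5 - N5 ** Z"

definition \<M> :: "state set" where
  "\<M> = SE23 \<times> UNIV"

definition ins_field :: "real^3 \<Rightarrow> input \<Rightarrow> state \<Rightarrow> state" where
  "ins_field g = (\<lambda>(w, \<tau>) (T, b).
     (T ** (wedge w - wedge b + N5) + (G5 g - N5) ** T, \<tau>))"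

definition \<phi> :: "mat5 \<times> mat5 \<Rightarrow> state \<Rightarrow> state" where
  "\<phi> = (\<lambda>(D, \<delta>) (T, b). (T ** D, Ad_vee (matrix_inv D) (b - vee \<delta>)))"

definition \<psi> :: "mat5 \<times> mat5 \<Rightarrow> input \<Rightarrow> input" where
  "\<psi> = (\<lambda>(D, \<delta>) (w, \<tau>).
     (Ad_vee (matrix_inv D) (w - vee \<delta>) + vee (\<Omega> (matrix_inv D)),
      Ad_vee (matrix_inv D) \<tau>))"


section \<open>Differentials and push-forward of vector fields\<close>

text \<open>
  For a submanifold \<open>S\<close> of a Euclidean space, tangent vectors are velocities of curves in \<open>S\<close>, and
  the differential of \<open>F\<close> sends the velocity of a curve \<open>\<gamma>\<close> to that of \<open>F \<circ> \<gamma>\<close>. At a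
  vector which is not tangent to \<open>S\<close>, \<open>differential\<close> is left unspecified.
\<close>

definition tangent_space :: "'a::real_normed_vector set \<Rightarrow> 'a \<Rightarrow> 'a set" where
  "tangent_space S x =
     {v. \<exists>\<gamma>. range \<gamma> \<subseteq> S \<and> \<gamma> 0 = x \<and> (\<gamma> has_vector_derivative v) (at 0)}"

definition differential ::
    "'a::real_normed_vector set \<Rightarrow> ('a \<Rightarrow> 'b::real_normed_vector) \<Rightarrow> 'a \<Rightarrow> 'a \<Rightarrow> 'b" where
  "differential S F x v =
     (THE w. \<exists>\<gamma>. range \<gamma> \<subseteq> S \<and> \<gamma> 0 = x \<and> (\<gamma> has_vector_derivative v) (at 0) \<and>
                 ((F \<circ> \<gamma>) has_vector_derivative w) (at 0))"

lemma differential_eq: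
  assumes F: "(F has_derivative F') (at x)" and v: "v \<in> tangent_space S x"
  shows "differential S F x v = F' v"
proof -
  have *: "((F \<circ> \<gamma>) has_vector_derivative F' v) (at 0)"
    if "\<gamma> 0 = x" "(\<gamma> has_vector_derivative v) (at 0)" for \<gamma> :: "real \<Rightarrow> 'a"
    using that F by (intro vector_derivative_diff_chain_within)
      (auto intro: has_derivative_at_withinI)
  show ?thesis
    unfolding differential_def
  proof (rule the_equality)
    show "\<exists>\<gamma>. range \<gamma> \<subseteq> S \<and> \<gamma> 0 = x \<and> (\<gamma> has_vector_derivative v) (at 0) \<and>
                 ((F \<circ> \<gamma>) has_vector_derivative F' v) (at 0)"
      using v * unfolding tangent_space_def by blast
  next
    fix w
    assume "\<exists>\<gamma>. range \<gamma> \<subseteq> S \<and> \<gamma> 0 = x \<and> (\<gamma> has_vector_derivative v) (at 0) \<and>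
                 ((F \<circ> \<gamma>) has_vector_derivative w) (at 0)"
    then show "w = F' v"
      using * vector_derivative_unique_at by blast
  qed
qed

definition pushforward ::
    "mat5 \<times> mat5 \<Rightarrow> (state \<Rightarrow> state) \<Rightarrow> state \<Rightarrow> state" where
  "pushforward X f \<xi> =
     (let \<eta> = \<phi> (inv\<^bsub>G_TG\<^esub> X) \<xi> in differential \<M> (\<phi> X) \<eta> (f \<eta>))"

end

theory Submission
  imports Defs
begin

text \<open>
  At \<open>X = (D, \<delta>)\<close> the map \<open>\<phi>\<^sub>X\<close> is affine on the ambient space, with linear part
  \<open>(V, c) \<mapsto> (V D, Ad_vee D\<^sup>-\<^sup>1 c)\<close>, and the field is tangent to \<open>\<M>\<close> because its matrix part has
  the block form \<open>(A hat \<omega> | A v + g | A p + a)\<close>. So the push-forward can be computed algebraically;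
  the two sides agree because \<open>N D = N\<close> gives \<open>D\<^sup>-\<^sup>1 N D = D\<^sup>-\<^sup>1 N = \<Omega> D\<^sup>-\<^sup>1 + N\<close>.
\<close>

section \<open>Indices 1 to 5 and block arithmetic\<close>

lemma exhaust_5: "x = 1 \<or> x = 2 \<or> x = 3 \<or> x = 4 \<or> x = 5" for x :: 5
proof (induct x)
  case (of_int z)
  \<comment> \<open>The residue 0 is the literal 5, so these five residues are exactly the five
    named indices.\<close>
  then have "z = 0 \<or> z = 1 \<or> z = 2 \<or> z = 3 \<or> z = 4" by simp arith
  then show ?case by auto
qed

lemma forall_5: "(\<forall>i::5. P i) \<longleftrightarrow> P 1 \<and> P 2 \<and> P 3 \<and> P 4 \<and> P 5"
  by (metis exhaust_5)

lemma UNIV_5: "UNIV = {1, 2, 3, 4, 5::5}"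
  using exhaust_5 by auto

lemma sum_5: "sum f (UNIV::5 set) = f 1 + f 2 + f 3 + f 4 + f 5"
  unfolding UNIV_5 by (simp add: ac_simps)

lemma vector_5:
  "(vector [a,b,c,d,e] :: 'a::zero^5) $ 1 = a"
  "(vector [a,b,c,d,e] :: 'a::zero^5) $ 2 = b"
  "(vector [a,b,c,d,e] :: 'a::zero^5) $ 3 = c"
  "(vector [a,b,c,d,e] :: 'a::zero^5) $ 4 = d"
  "(vector [a,b,c,d,e] :: 'a::zero^5) $ 5 = e"
  unfolding vector_def by simp_all

lemma block5_eq_iff:
  "block5 c A a b = block5 d B v p \<longleftrightarrow> c = d \<and> A = B \<and> a = v \<and> b = p"
  by (auto simp: block5_def vec_eq_iff forall_5 forall_3 vector_5)

lemma block5_mult: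
  "block5 c A a b ** block5 d B v p = block5 (c * d) (A ** B) (A *v v + d *\<^sub>R a) (A *v p + d *\<^sub>R b)"
  by (simp add: block5_def vec_eq_iff forall_5 vector_5 matrix_matrix_mult_def
      matrix_vector_mult_def sum_5 sum_3)

lemma block5_add: "block5 c A a b + block5 d B v p = block5 (c + d) (A + B) (a + v) (b + p)"
  by (simp add: block5_def vec_eq_iff forall_5 vector_5)

lemma block5_scaleR: "r *\<^sub>R block5 c A a b = block5 (r * c) (r *\<^sub>R A) (r *\<^sub>R a) (r *\<^sub>R b)"
  by (simp add: block5_def vec_eq_iff forall_5 vector_5)

lemma mat_1_block5: "(mat 1 :: mat5) = block5 1 (mat 1) 0 0"
  by (simp add: block5_def vec_eq_iff forall_5 vector_5 mat_def)

section \<open>Skew-symmetric matrices and rotations\<close>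

lemma hat_eq:
  "hat \<omega> = vector [vector [0, - \<omega>$3, \<omega>$2], vector [\<omega>$3, 0, - \<omega>$1], vector [- \<omega>$2, \<omega>$1, 0]]"
  by (simp add: hat_def matrix_def cross3_def vec_eq_iff forall_3 axis_def)

lemma inj_hat: "inj hat"
  by (rule injI) (simp add: hat_eq vec_eq_iff forall_3)

lemma linear_hat: "linear hat"
  by (rule linearI) (simp_all add: hat_eq vec_eq_iff forall_3)

lemma hat_mult_vector: "hat \<omega> *v x = cross3 \<omega> x"
  by (simp add: hat_eq cross3_def vec_eq_iff forall_3 matrix_vector_mult_def sum_3)

text \<open>Rotations preserve the cross product, so A maps \<omega> \<times> (A^T x) to (A
  \<omega>) \<times> (A A^T x), and A A^T = 1.\<close>

lemma hat_rotation:
  assumes "rotation_matrix A"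
  shows "A ** hat \<omega> ** transpose A = hat (A *v \<omega>)"
proof -
  have "A *v (transpose A *v x) = x" for x
    using assms by (simp add: rotation_matrix_def orthogonal_matrix_def matrix_vector_mul_assoc
        del: transpose_matrix_vector)
  then have "(A ** hat \<omega> ** transpose A) *v x = hat (A *v \<omega>) *v x" for x
    using assms by (simp add: matrix_vector_mul_assoc[symmetric] hat_mult_vector
        cross_rotation_matrix[symmetric] del: transpose_matrix_vector)
  then show ?thesis
    by (simp add: matrix_eq)
qed

text \<open>Put K = \<open>hat \<omega>\<close>. Transposition negates K, and K^4 = -|\<omega>|^2
  K^2, so R^T R = (1 + \<beta> K^2)^2 - \<alpha>^2 K^2 differs from 1 by a multiple of K^2 whose
  coefficient the hypothesis makes zero. Orthogonality leaves the sign of the determinant open; it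
  is computed separately, and the same coefficient appears.\<close>

lemma rotation_quadratic_hat:
  fixes \<omega> :: "real^3"
  assumes "2 * \<beta> = \<alpha>\<^sup>2 + \<beta>\<^sup>2 * (\<omega> \<bullet> \<omega>)"
  shows "rotation_matrix (mat 1 + \<alpha> *\<^sub>R hat \<omega> + \<beta> *\<^sub>R (hat \<omega> ** hat \<omega>))" (is "rotation_matrix ?R")
proof -
  have "transpose ?R ** ?R
      = mat 1 + (2 * \<beta> - \<alpha>\<^sup>2 - \<beta>\<^sup>2 * (\<omega> \<bullet> \<omega>)) *\<^sub>R (hat \<omega> ** hat \<omega>)"
    by (simp add: vec_eq_iff forall_3 hat_eq matrix_matrix_mult_def sum_3 transpose_def mat_def
        inner_vec_def algebra_simps power2_eq_square)
  moreover have "det ?R = 1 - (\<omega> \<bullet> \<omega>) * (2 * \<beta> - \<alpha>\<^sup>2 - \<beta>\<^sup>2 * (\<omega> \<bullet> \<omega>))"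
    by (simp add: det_3 hat_eq matrix_matrix_mult_def sum_3 mat_def
        inner_vec_def algebra_simps power2_eq_square)
  ultimately show ?thesis
    using assms by (simp add: rotation_matrix_def orthogonal_matrix)
qed

text \<open>
  The curve is the Cayley transform of \<open>t \<omega> / 2\<close>; unlike the exponential it is rational in \<open>t\<close>.
\<close>

lemma rotation_curve:
  obtains R :: "real \<Rightarrow> real^3^3"
  where "\<And>t. rotation_matrix (R t)" "R 0 = mat 1" "(R has_vector_derivative hat \<omega>) (at 0)"
proof -
  \<comment> \<open>\<open>s t\<close> is the determinant of 1 - t K / 2 for K =
    \<open>hat \<omega>\<close>. Since K^3 = -|\<omega>|^2 K, the product of (1 - t K / 2)^(-1) and
    1 + t K / 2 reduces to the quadratic polynomial in K that defines \<open>R\<close>.\<close>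
  define s where "s = (\<lambda>t. 1 + t\<^sup>2 * (\<omega> \<bullet> \<omega>) / 4)"
  define R where "R = (\<lambda>t. mat 1 + (t / s t) *\<^sub>R hat \<omega> + (t\<^sup>2 / (2 * s t)) *\<^sub>R (hat \<omega> ** hat \<omega>))"
  have "rotation_matrix (R t)" for t
    unfolding R_def
  proof (rule rotation_quadratic_hat)
    have "s t > 0"
      unfolding s_def by (intro add_pos_nonneg) simp_all
    \<comment> \<open>Eliminating |\<omega>|^2 in favour of \<open>s t\<close> leaves a rational
      identity in t and \<open>s t\<close>.\<close>
    moreover have "t\<^sup>2 * (\<omega> \<bullet> \<omega>) = 4 * s t - 4"
      by (simp add: s_def)
    ultimately show "2 * (t\<^sup>2 / (2 * s t)) = (t / s t)\<^sup>2 + (t\<^sup>2 / (2 * s t))\<^sup>2 * (\<omega> \<bullet> \<omega>)"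
      by (simp add: field_simps) algebra
  qed
  moreover have "R 0 = mat 1"
    by (simp add: R_def)
  moreover have "(R has_vector_derivative hat \<omega>) (at 0)"
    unfolding R_def s_def by (auto intro!: derivative_eq_intros)
  ultimately show thesis using that by blast
qed

section \<open>Matrix products and inverses\<close>

lemma bounded_bilinear_matrix_mult:
  "bounded_bilinear ((**) :: real^'n^'m \<Rightarrow> real^'p^'n \<Rightarrow> real^'p^'m)"
  unfolding bilinear_conv_bounded_bilinear[symmetric] bilinear_def
  by (intro conjI allI linearI)
    (simp_all add: vec_eq_iff matrix_matrix_mult_def sum.distrib sum_distrib_left
      distrib_left distrib_right mult.assoc mult.left_commute)

lemmas matrix_mult_linear_simps =
  bounded_bilinear.add_left[OF bounded_bilinear_matrix_mult]
  bounded_bilinear.add_right[OF bounded_bilinear_matrix_mult]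
  bounded_bilinear.diff_left[OF bounded_bilinear_matrix_mult]
  bounded_bilinear.diff_right[OF bounded_bilinear_matrix_mult]
  bounded_bilinear.minus_left[OF bounded_bilinear_matrix_mult]
  bounded_bilinear.minus_right[OF bounded_bilinear_matrix_mult]
  bounded_bilinear.scaleR_left[OF bounded_bilinear_matrix_mult]
  bounded_bilinear.scaleR_right[OF bounded_bilinear_matrix_mult]
  bounded_bilinear.zero_left[OF bounded_bilinear_matrix_mult]
  bounded_bilinear.zero_right[OF bounded_bilinear_matrix_mult]

text \<open>A one-sided inverse of a square matrix is two-sided, so the choice behind
  \<open>matrix_inv\<close> has a witness and yields a genuine inverse, which is unique. Later
  inverses are thus found by checking one product.\<close>

lemma matrix_inv_unique:
  fixes A B :: "real^'n^'n"
  assumes "A ** B = mat 1"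
  shows "matrix_inv A = B"
proof -
  have BA: "B ** A = mat 1"
    using assms matrix_left_right_inverse by blast
  have "A ** matrix_inv A = mat 1 \<and> matrix_inv A ** A = mat 1"
    unfolding matrix_inv_def by (rule someI[where x = B]) (simp add: assms BA)
  then show ?thesis
    by (metis BA matrix_mul_assoc matrix_mul_lid matrix_mul_rid)
qed

section \<open>The group \<open>SE23\<close>\<close>

lemma block5_SE23_iff: "block5 1 A a b \<in> SE23 \<longleftrightarrow> rotation_matrix A"
  by (auto simp: SE23_def block5_eq_iff)

lemma block5_hat_se23: "block5 0 (hat \<omega>) v p \<in> se23"
  unfolding se23_def wedge_def by (rule range_eqI[where x = "(\<omega>, v, p)"]) simp

lemma SE23_mult:
  assumes "D \<in> SE23" "E \<in> SE23"
  shows "D ** E \<in> SE23"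
proof -
  obtain A a b B v p where "D = block5 1 A a b" "E = block5 1 B v p"
    "rotation_matrix A" "rotation_matrix B"
    using assms unfolding SE23_def by blast
  then show ?thesis
    using block5_mult[of 1 A a b 1 B v p]
    by (simp add: block5_SE23_iff rotation_matrix_def orthogonal_matrix_mul det_mul)
qed

lemma SE23_one: "mat 1 \<in> SE23"
  by (simp add: mat_1_block5 block5_SE23_iff rotation_matrix_def orthogonal_matrix_id)

text \<open>The last two columns of the inverse solve A x + a = 0 and A x + b = 0, where A^T inverts
  A.\<close>

lemma block5_inv:
  assumes "rotation_matrix A"
  shows "block5 1 A a b ** block5 1 (transpose A) (- (transpose A *v a)) (- (transpose A *v b)) = mat 1"
proof -
  have "A ** transpose A = mat 1"
    using assms by (simp add: rotation_matrix_def orthogonal_matrix_def)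
  moreover from this have "A *v (- (transpose A *v x)) = - x" for x
    by (simp add: linear_neg[OF matrix_vector_mul_linear] matrix_vector_mul_assoc
        del: transpose_matrix_vector)
  ultimately show ?thesis
    by (simp add: block5_mult mat_1_block5 del: transpose_matrix_vector)
qed

lemma SE23_matrix_inv:
  assumes "D \<in> SE23"
  shows "matrix_inv D \<in> SE23" "D ** matrix_inv D = mat 1" "matrix_inv D ** D = mat 1"
    "matrix_inv (matrix_inv D) = D"
proof -
  obtain A a b where D: "D = block5 1 A a b" "rotation_matrix A"
    using assms by (auto simp: SE23_def)
  note inv = block5_inv[OF D(2), of a b, folded D(1)]
  show "matrix_inv D \<in> SE23"
    using D(2) by (simp add: matrix_inv_unique[OF inv] block5_SE23_iff rotation_matrix_def
        det_transpose del: transpose_matrix_vector)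
  show right: "D ** matrix_inv D = mat 1"
    using inv matrix_inv_unique by metis
  then show left: "matrix_inv D ** D = mat 1"
    using matrix_left_right_inverse by blast
  then show "matrix_inv (matrix_inv D) = D"
    by (rule matrix_inv_unique)
qed

lemma matrix_inv_mult:
  assumes "D \<in> SE23" "E \<in> SE23"
  shows "matrix_inv (D ** E) = matrix_inv E ** matrix_inv D"
proof (rule matrix_inv_unique)
  have "D ** E ** (matrix_inv E ** matrix_inv D) = D ** (E ** matrix_inv E) ** matrix_inv D"
    by (simp add: matrix_mul_assoc)
  then show "D ** E ** (matrix_inv E ** matrix_inv D) = mat 1"
    using assms by (simp add: SE23_matrix_inv)
qed

section \<open>The Lie algebra and the adjoint action\<close>

lemma linear_block5: "linear (\<lambda>(A, a, b). block5 0 A a b)"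
  by (rule linearI) (auto simp: block5_add block5_scaleR)

lemma linear_wedge: "linear wedge"
  by (rule linearI) (auto simp: wedge_def block5_add block5_scaleR
      linear_add[OF linear_hat] linear_scale[OF linear_hat])

lemma inj_wedge: "inj wedge"
  by (rule injI) (auto simp: wedge_def block5_eq_iff inj_eq[OF inj_hat])

lemma vee_wedge [simp]: "vee (wedge u) = u"
  unfolding vee_def by (rule the_inv_f_f[OF inj_wedge])

lemma wedge_vee: "\<eta> \<in> se23 \<Longrightarrow> wedge (vee \<eta>) = \<eta>"
  by (auto simp: se23_def)

lemma vee_uminus: "\<eta> \<in> se23 \<Longrightarrow> vee (- \<eta>) = - vee \<eta>"
  by (auto simp: se23_def linear_neg[OF linear_wedge, symmetric])

lemma subspace_se23: "subspace se23"
  unfolding se23_def by (rule linear_subspace_image[OF linear_wedge subspace_UNIV])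

text \<open>Conjugation keeps the last two rows zero and turns the rotation block into A
  \<open>hat \<omega>\<close> A^T, which \<open>hat_rotation\<close> shows to be skew-symmetric
  again.\<close>

lemma Ad_se23:
  assumes "D \<in> SE23" "\<eta> \<in> se23"
  shows "Ad D \<eta> \<in> se23"
proof -
  obtain A a b where D: "D = block5 1 A a b" and A: "rotation_matrix A"
    using assms by (auto simp: SE23_def)
  obtain \<omega> v p where \<eta>: "\<eta> = block5 0 (hat \<omega>) v p"
    using assms by (auto simp: se23_def wedge_def)
  show ?thesis
    by (simp add: Ad_def D \<eta> matrix_inv_unique[OF block5_inv[OF A]] block5_mult hat_rotation[OF A]
        block5_hat_se23)
qed

lemma wedge_Ad_vee: "D \<in> SE23 \<Longrightarrow> wedge (Ad_vee D u) = Ad D (wedge u)"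
  unfolding Ad_vee_def by (intro wedge_vee Ad_se23) (auto simp: se23_def)

lemma Ad_vee_vee: "\<eta> \<in> se23 \<Longrightarrow> Ad_vee D (vee \<eta>) = vee (Ad D \<eta>)"
  by (simp add: Ad_vee_def wedge_vee)

lemma linear_Ad: "linear (Ad D)"
  unfolding Ad_def
  by (intro linearI) (simp_all add: matrix_mult_linear_simps)

text \<open>\<open>vee\<close> is unspecified off \<open>se23\<close>, so both sides are compared
  after applying the injective linear map \<open>wedge\<close>, where linearity of \<open>Ad\<close>
  applies.\<close>

lemma linear_Ad_vee:
  assumes "D \<in> SE23"
  shows "linear (Ad_vee D)"
proof (rule linearI)
  note simps = wedge_Ad_vee[OF assms]
  show "Ad_vee D (x + y) = Ad_vee D x + Ad_vee D y" for x y
    by (rule injD[OF inj_wedge])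
      (simp add: simps linear_add[OF linear_wedge] linear_add[OF linear_Ad])
  show "Ad_vee D (r *\<^sub>R x) = r *\<^sub>R Ad_vee D x" for r x
    by (rule injD[OF inj_wedge])
      (simp add: simps linear_scale[OF linear_wedge] linear_scale[OF linear_Ad])
qed

lemma Ad_mult:
  assumes "D \<in> SE23" "E \<in> SE23"
  shows "Ad (D ** E) \<eta> = Ad D (Ad E \<eta>)"
  by (simp add: Ad_def matrix_inv_mult[OF assms] matrix_mul_assoc)

lemma Ad_one [simp]: "Ad (mat 1) \<eta> = \<eta>"
  by (simp add: Ad_def matrix_inv_unique[of "mat 1" "mat 1"])

section \<open>The semidirect product \<open>G_TG\<close> and its inverse\<close>

lemma group_G_TG: "group G_TG"
proof (rule groupI)
  fix X Y assume "X \<in> carrier G_TG" "Y \<in> carrier G_TG"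
  then show "X \<otimes>\<^bsub>G_TG\<^esub> Y \<in> carrier G_TG"
    by (auto simp: G_TG_def SE23_mult Ad_se23 subspace_add[OF subspace_se23])
next
  show "\<one>\<^bsub>G_TG\<^esub> \<in> carrier G_TG"
    by (simp add: G_TG_def SE23_one subspace_0[OF subspace_se23])
next
  fix X Y Z assume "X \<in> carrier G_TG" "Y \<in> carrier G_TG" "Z \<in> carrier G_TG"
  then show "X \<otimes>\<^bsub>G_TG\<^esub> Y \<otimes>\<^bsub>G_TG\<^esub> Z = X \<otimes>\<^bsub>G_TG\<^esub> (Y \<otimes>\<^bsub>G_TG\<^esub> Z)"
    by (auto simp: G_TG_def matrix_mul_assoc Ad_mult linear_add[OF linear_Ad])
next
  fix X assume "X \<in> carrier G_TG"
  then show "\<one>\<^bsub>G_TG\<^esub> \<otimes>\<^bsub>G_TG\<^esub> X = X"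
    by (auto simp: G_TG_def)
next
  fix X assume "X \<in> carrier G_TG"
  then obtain D \<delta> where "X = (D, \<delta>)" "D \<in> SE23" "\<delta> \<in> se23"
    by (auto simp: G_TG_def)
  then show "\<exists>Y\<in>carrier G_TG. Y \<otimes>\<^bsub>G_TG\<^esub> X = \<one>\<^bsub>G_TG\<^esub>"
    \<comment> \<open>The second component of the witness solves x +
      \<open>Ad (matrix_inv D) \<delta>\<close> = 0.\<close>
    by (intro bexI[where x = "(matrix_inv D, - Ad (matrix_inv D) \<delta>)"])
      (auto simp: G_TG_def SE23_matrix_inv Ad_se23 subspace_neg[OF subspace_se23])
qed

lemma inv_G_TG:
  assumes "D \<in> SE23" "\<delta> \<in> se23"
  shows "inv\<^bsub>G_TG\<^esub> (D, \<delta>) = (matrix_inv D, - Ad (matrix_inv D) \<delta>)"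
  using assms
  by (intro group.inv_equality[OF group_G_TG])
    (auto simp: G_TG_def SE23_matrix_inv Ad_se23 subspace_neg[OF subspace_se23])

section \<open>The drift term and tangency of the field\<close>

lemma N5_mult_SE23: "Z \<in> SE23 \<Longrightarrow> N5 ** Z = N5"
  by (auto simp: SE23_def N5_def block5_def vec_eq_iff forall_5 vector_5
      matrix_matrix_mult_def sum_5)

text \<open>Right multiplication by \<open>N5\<close> moves column 4 to column 5; left
  multiplication moves row 5 to row 4. The two entries 1 in position (4,5) cancel, and only a
  survives.\<close>

lemma \<Omega>_block5: "\<Omega> (block5 1 A a b) = block5 0 0 0 a"
  by (simp add: \<Omega>_def N5_def block5_def vec_eq_iff forall_5 vector_5
      matrix_matrix_mult_def sum_5)

lemma \<Omega>_se23: "Z \<in> SE23 \<Longrightarrow> \<Omega> Z \<in> se23"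
  using block5_hat_se23[of 0] by (auto simp: SE23_def \<Omega>_block5 linear_0[OF linear_hat])

lemma ins_field_tangent:
  assumes "\<xi> \<in> \<M>"
  shows "ins_field g u \<xi> \<in> tangent_space \<M> \<xi>"
proof -
  obtain A a c b w \<tau> where \<xi>: "\<xi> = (block5 1 A a c, b)" and A: "rotation_matrix A"
    and u: "u = (w, \<tau>)"
    using assms by (cases \<xi>, cases u) (auto simp: \<M>_def SE23_def)
  obtain \<omega> v p where wb: "w - b = (\<omega>, v, p)"
    by (metis prod_cases3)
  let ?T = "block5 1 A a c"
  \<comment> \<open>Collecting T N - N T into \<open>\<Omega>\<close> leaves three summands, each
    with zero last rows.\<close>
  have "?T ** (wedge w - wedge b + N5) + (G5 g - N5) ** ?T
      = ?T ** wedge (w - b) + G5 g ** ?T + \<Omega> ?T"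
    by (simp add: \<Omega>_def matrix_mult_linear_simps linear_diff[OF linear_wedge])
  also have "\<dots> = block5 0 (A ** hat \<omega>) (A *v v + g) (A *v p + a)"
    by (simp add: wb wedge_def G5_def \<Omega>_block5 block5_mult block5_add
        matrix_mult_linear_simps)
  finally have field: "ins_field g u \<xi> = (block5 0 (A ** hat \<omega>) (A *v v + g) (A *v p + a), \<tau>)"
    by (simp add: ins_field_def u \<xi>)
  obtain R where R: "\<And>t. rotation_matrix (R t)" "R 0 = mat 1"
    "(R has_vector_derivative hat \<omega>) (at 0)"
    using rotation_curve[of \<omega>] by blast
  let ?h = "\<lambda>t. (A ** R t, a + t *\<^sub>R (A *v v + g), c + t *\<^sub>R (A *v p + a))"
  \<comment> \<open>Only the velocity at 0 has to match, so the translations and the bias move along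
    straight lines, and the rotation block along A \<open>R t\<close>. The constant summand supplies
    the corner identity, which the linear block map leaves zero.\<close>
  define \<gamma> where "\<gamma> = (\<lambda>t::real. (block5 1 0 0 0 + (\<lambda>(A, a, b). block5 0 A a b) (?h t), b + t *\<^sub>R \<tau>))"
  have "((\<lambda>t. A ** R t) has_vector_derivative A ** hat \<omega>) (at 0)"
    by (rule bounded_linear.has_vector_derivative[OF
          bounded_bilinear.bounded_linear_right[OF bounded_bilinear_matrix_mult] R(3)])
  then have "(?h has_vector_derivative (A ** hat \<omega>, A *v v + g, A *v p + a)) (at 0)"
    by (intro has_vector_derivative_Pair) (auto intro!: derivative_eq_intros)
  from bounded_linear.has_vector_derivative[OF linear_conv_bounded_linear[THEN iffD1, OF linear_block5] this]
  have "(\<gamma> has_vector_derivative ins_field g u \<xi>) (at 0)"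
    unfolding \<gamma>_def field
    by (intro has_vector_derivative_Pair) (auto intro!: derivative_eq_intros)
  moreover have "\<gamma> t \<in> \<M>" for t
    using A R(1)[of t]
    by (simp add: \<gamma>_def \<M>_def block5_add block5_SE23_iff rotation_matrix_def det_mul
        orthogonal_matrix_mul)
  moreover have "\<gamma> 0 = \<xi>"
    by (simp add: \<gamma>_def \<xi> R(2) block5_add)
  ultimately show ?thesis
    unfolding tangent_space_def by (intro CollectI exI[where x = \<gamma>]) auto
qed

section \<open>The differential of the state action\<close>

lemma has_derivative_\<phi>:
  assumes "D \<in> SE23"
  shows "(\<phi> (D, \<delta>) has_derivative (\<lambda>(V, c). (V ** D, Ad_vee (matrix_inv D) c))) (at \<xi>)"
proof -
  let ?L = "\<lambda>(V, c). (V ** D, Ad_vee (matrix_inv D) c)"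
  note lin = linear_Ad_vee[OF SE23_matrix_inv(1)[OF assms]]
  have "linear ?L"
    by (rule linearI) (simp_all add: split_beta linear_add[OF lin] linear_scale[OF lin]
        matrix_mult_linear_simps)
  then have "((\<lambda>\<xi>. ?L \<xi> + (0, - Ad_vee (matrix_inv D) (vee \<delta>))) has_derivative ?L) (at \<xi>)"
    by (intro has_derivative_add_const bounded_linear_imp_has_derivative
        linear_conv_bounded_linear[THEN iffD1])
  also have "(\<lambda>\<xi>. ?L \<xi> + (0, - Ad_vee (matrix_inv D) (vee \<delta>))) = \<phi> (D, \<delta>)"
    by (auto simp: \<phi>_def fun_eq_iff linear_diff[OF lin])
  finally show ?thesis .
qed

theorem theorem5p5p3:
  fixes g :: "real^3" and X :: "mat5 \<times> mat5" and u :: input and \<xi> :: state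
  assumes "X \<in> carrier G_TG" and "\<xi> \<in> \<M>"
  shows "ins_field g (\<psi> X u) \<xi> = pushforward X (ins_field g u) \<xi>"
proof -
  obtain D \<delta> where X: "X = (D, \<delta>)" and D: "D \<in> SE23" and \<delta>: "\<delta> \<in> se23"
    using assms by (auto simp: G_TG_def)
  obtain T b where \<xi>: "\<xi> = (T, b)" and T: "T \<in> SE23"
    using assms by (auto simp: \<M>_def)
  obtain w \<tau> where u: "u = (w, \<tau>)" by (cases u)
  let ?E = "matrix_inv D"
  note E = SE23_matrix_inv[OF D]
  have "Ad D (Ad ?E \<delta>) = \<delta>"
    using Ad_mult[OF D E(1)] E(2) by simp
  \<comment> \<open>The inverse of X shifts the bias by +\<open>Ad ?E \<delta>\<close> before
    \<open>Ad D\<close> is applied, and \<open>Ad D\<close> turns this shift back into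
    \<delta>.\<close>
  then have inv: "\<phi> (inv\<^bsub>G_TG\<^esub> X) \<xi> = (T ** ?E, Ad_vee D b + vee \<delta>)"
    using D \<delta> E by (simp add: X \<xi> \<phi>_def inv_G_TG linear_diff[OF linear_Ad_vee] Ad_vee_vee
        Ad_se23 subspace_neg[OF subspace_se23] linear_neg[OF linear_Ad_vee] vee_uminus)
  let ?\<eta> = "(T ** ?E, Ad_vee D b + vee \<delta>)"
  have "?\<eta> \<in> \<M>"
    by (simp add: \<M>_def SE23_mult T E(1))
  \<comment> \<open>Tangency of the field at \<open>?\<eta>\<close> allows
    \<open>differential\<close> to be replaced by the ambient derivative.\<close>
  then have "pushforward X (ins_field g u) \<xi>
      = (\<lambda>(V, c). (V ** D, Ad_vee ?E c)) (ins_field g u ?\<eta>)"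
    unfolding pushforward_def Let_def inv unfolding X
    by (intro differential_eq[OF has_derivative_\<phi>[OF D]] ins_field_tangent)
  also have "\<dots> = ((T ** ?E ** (wedge w - Ad D (wedge b) - \<delta> + N5) + (G5 g - N5) ** (T ** ?E)) ** D,
      Ad_vee ?E \<tau>)"
    by (simp add: ins_field_def u linear_add[OF linear_wedge] wedge_Ad_vee D wedge_vee \<delta>
        diff_diff_eq)
  \<comment> \<open>Moving the final D inside produces the conjugation \<open>Ad ?E\<close> on the
    Lie algebra terms; the \<open>N5\<close> term is kept apart so that D can be absorbed into
    \<open>N5\<close>.\<close>
  also have "(T ** ?E ** (wedge w - Ad D (wedge b) - \<delta> + N5) + (G5 g - N5) ** (T ** ?E)) ** D
      = T ** (Ad ?E (wedge w - \<delta>) - Ad ?E (Ad D (wedge b)) + ?E ** (N5 ** D))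
        + (G5 g - N5) ** (T ** (?E ** D))"
    by (simp add: Ad_def E(4) matrix_mult_linear_simps matrix_mul_assoc)
  also have "\<dots> = T ** (Ad ?E (wedge w - \<delta>) - wedge b + ?E ** N5) + (G5 g - N5) ** T"
    using Ad_mult[OF E(1) D] by (simp add: E(3) N5_mult_SE23 D)
  also have "?E ** N5 = \<Omega> ?E + N5"
    by (simp add: \<Omega>_def N5_mult_SE23 E(1))
  \<comment> \<open>\<open>\<Omega> ?E\<close> lies in \<open>se23\<close>, so \<open>wedge\<close>
    undoes the \<open>vee\<close> in \<open>\<psi>\<close> and the bracket reassembles into the
    transformed input.\<close>
  also have "T ** (Ad ?E (wedge w - \<delta>) - wedge b + (\<Omega> ?E + N5)) + (G5 g - N5) ** T
      = T ** (wedge (fst (\<psi> X u)) - wedge b + N5) + (G5 g - N5) ** T"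
    by (simp add: \<psi>_def X u linear_add[OF linear_wedge] linear_diff[OF linear_wedge] wedge_Ad_vee
        wedge_vee \<delta> \<Omega>_se23 E(1) algebra_simps)
  finally show ?thesis
    by (simp add: ins_field_def \<psi>_def X u \<xi>)
qed

end
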